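(* Let $p_n(x)$ be the orthogonal polynomials satisfying the general three-term recurrence $\alpha_{n+1}p_{n+1}(x)=(x-\beta_n)p_n(x)-\gamma_{n-1}p_{n-1}(x)$, and suppose that $\alpha_n=1$, $\beta_n=b_n$ and $\gamma_n=\lambda_{n+1}$, so that the $p_n$ are monic and $$p_{n+1}(x)=(x-b_n)p_n(x)-\lambda_n p_{n-1}(x).$$ Let $L$ be the positive definite linear functional on polynomials corresponding to the $p_n$. Then for non-negative integers $m,n,k$, $$L(p_mp_np_k)=\lambda_1\cdots\lambda_n\sum_{P} w(P),$$ where $P$ runs over the Motzkin paths from $(0,m)$ to $(k,n)$, and $w(P)=\prod_{\text{edges } e \text{ of } P} w(e)$ with $$w(\text{edge starting at }(i,j))=\begin{cases} b_j-b_i & \text{if the edge is } H,\\ \lambda_j-\lambda_{i+1} & \text{if the edge is } D \text{ and is followed by } U,\\ \lambda_j & \text{if the edge is } D \text{ and is not followed by } U,\\ 1 & \text{if the edge is } U.\end{cases}$$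
   Context: A Motzkin path is a lattice path in the plane which lies at or above the $x$-axis and has steps $(1,0)$ (horizontal, $H$), $(1,1)$ (up, $U$), or $(1,-1)$ (down, $D$). The functional $L$ is given by $L(x^n)=\mu_n$, the $n$th moment of a measure for the orthogonal polynomials $p_n(x)$. It satisfies $L(p_ip_j)=0$ for $i\ne j$ and $L(p_kp_k)=\lambda_1\cdots\lambda_k>0$. The polynomials are normalized by $p_{-1}=0$, $p_0=1$, and $L(1)=1$. Empty products equal $1$.
   Formalization: The formula is proved only for k ≤ m+n+1, not for all non-negative m, n, k; beyond that it fails as printed: for m=n=0, k=2 the left side is L(p_2)=0 while the sum over Motzkin paths is λ_1>0. *)

theory Defs
  imports Complex_Main "HOL-Computational_Algebra.Polynomial"
begin

(* The term with p_{-1} = 0 is dropped at n = 0, so gamma_{-1} never occurs. *)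
definition three_term_recurrence ::
    "(nat \<Rightarrow> real) \<Rightarrow> (nat \<Rightarrow> real) \<Rightarrow> (nat \<Rightarrow> real) \<Rightarrow> (nat \<Rightarrow> real poly) \<Rightarrow> bool" where
  "three_term_recurrence \<alpha> \<beta> \<gamma> p \<longleftrightarrow>
     p 0 = 1 \<and>
     (\<forall>n. smult (\<alpha> (n + 1)) (p (n + 1)) =
            [:- \<beta> n, 1:] * p n - (if n = 0 then 0 else smult (\<gamma> (n - 1)) (p (n - 1))))"

definition positive_definite_functional :: "(real poly \<Rightarrow> real) \<Rightarrow> bool" where
  "positive_definite_functional L \<longleftrightarrow>
     Vector_Spaces.linear smult (*) L \<and>
     (\<forall>q. q \<noteq> 0 \<longrightarrow> (\<forall>x. poly q x \<ge> 0) \<longrightarrow> L q > 0)"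

(* The squared norms L (p k * p k) are not prescribed: for monic p they are forced by
   the recurrence, linearity and L 1 = 1. *)
definition functional_of :: "(real poly \<Rightarrow> real) \<Rightarrow> (nat \<Rightarrow> real poly) \<Rightarrow> bool" where
  "functional_of L p \<longleftrightarrow>
     positive_definite_functional L \<and> L 1 = 1 \<and> (\<forall>i j. i \<noteq> j \<longrightarrow> L (p i * p j) = 0)"

datatype step = Hor | Up | Down

fun rise :: "step \<Rightarrow> int" where
  "rise Hor = 0"
| "rise Up = 1"
| "rise Down = -1"

(* A path starting at (0, m) is given by its list of steps; after i steps it is at the point
   (i, height m s i), which is where step number i (counted from 0) starts. *)
definition height :: "nat \<Rightarrow> step list \<Rightarrow> nat \<Rightarrow> int" where
  "height m s i = int m + (\<Sum>t<i. rise (s ! t))"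

(* The Motzkin paths from (0, m) to (k, n). *)
definition motzkin_paths :: "nat \<Rightarrow> nat \<Rightarrow> nat \<Rightarrow> step list set" where
  "motzkin_paths m k n =
     {s. length s = k \<and> (\<forall>i\<le>k. height m s i \<ge> 0) \<and> height m s k = int n}"

lemma finite_motzkin_paths: "finite (motzkin_paths m k n)"
proof (rule finite_subset)
  have "x \<in> {Hor, Up, Down}" for x by (cases x) auto
  then show "motzkin_paths m k n \<subseteq> {s. set s \<subseteq> {Hor, Up, Down} \<and> length s = k}"
    by (auto simp: motzkin_paths_def)
  show "finite {s. set s \<subseteq> {Hor, Up, Down} \<and> length s = k}"
    by (rule finite_lists_length_eq) simp
qed

(* Heights on a Motzkin path are non-negative, so nat only changes the type. *)
definition edge_weight :: "(nat \<Rightarrow> real) \<Rightarrow> (nat \<Rightarrow> real) \<Rightarrow> nat \<Rightarrow> step list \<Rightarrow> nat \<Rightarrow> real" where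
  "edge_weight b lam m s i =
     (let j = nat (height m s i) in
      case s ! i of
        Hor \<Rightarrow> b j - b i
      | Down \<Rightarrow> (if i + 1 < length s \<and> s ! (i + 1) = Up then lam j - lam (i + 1) else lam j)
      | Up \<Rightarrow> 1)"

definition path_weight :: "(nat \<Rightarrow> real) \<Rightarrow> (nat \<Rightarrow> real) \<Rightarrow> nat \<Rightarrow> step list \<Rightarrow> real" where
  "path_weight b lam m s = (\<Prod>i<length s. edge_weight b lam m s i)"

(* With these weights the linearization formula
     L (p_m p_n p_k) = lambda_1 ... lambda_n * (sum of path weights)
   holds for k <= m + n + 1 but not in general.  A path with a Down-Up pair starting on the x-axis is not
   a Motzkin path, but the term - lambda_{i+1} of that pair is needed as soon as the
   axis can be reached from (0, m) and left again towards (k, n), that is, if k >= m + n + 2.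
   For m = n = 0 and k = 2 the left-hand side is L (p_2) = 0 and the sum is lambda_1 > 0. *)

end

theory Submission
  imports Defs
begin

text \<open>
  The path sums, multiplied by \<open>\<lambda>\<^sub>1 \<cdots> \<lambda>\<^sub>n\<close>, satisfy the same recurrence in \<open>k\<close> as the values of \<open>L\<close>.

  On the analytic side, expanding \<open>L (x p\<^sub>m p\<^sub>n p\<^sub>k)\<close> once through \<open>x p\<^sub>n\<close> and once through
  \<open>x p\<^sub>k\<close> expresses \<open>L (p\<^sub>m p\<^sub>n p\<^bsub>k+1\<^esub>)\<close> by the values at level \<open>k\<close> with \<open>n - 1\<close>, \<open>n\<close>, \<open>n + 1\<close> and
  the value at level \<open>k - 1\<close> with \<open>n\<close> (\<open>triple_product_recurrence\<close>).  Orthogonality enters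
  only at \<open>k = 0\<close>, where it gives \<open>\<lambda>\<^sub>1 \<cdots> \<lambda>\<^sub>n\<close> if \<open>m = n\<close> and \<open>0\<close> otherwise.

  On the combinatorial side, removing the last step of a path with \<open>k + 1\<close> steps that ends at
  height \<open>n\<close> gives the three terms at level \<open>k\<close>.
  Removing a final \<open>Up\<close> changes the weight of a preceding \<open>Down\<close> that starts at \<open>(k - 1, n)\<close>
  from \<open>\<lambda>\<^sub>n - \<lambda>\<^sub>k\<close> to \<open>\<lambda>\<^sub>n\<close>; the resulting corrections add up to \<open>\<lambda>\<^sub>k\<close> times the sum over the paths
  to \<open>(k - 1, n)\<close>, which is the term at level \<open>k - 1\<close> (\<open>path_weight_sum_recurrence\<close>).

  The two recurrences differ only at \<open>n = 0\<close>: a path may not dip below the axis, so there the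
  correction term is missing on the combinatorial side.  For \<open>k + 1 \<le> m + 1\<close> the missing term is
  zero anyway, because a path from height \<open>m\<close> needs at least \<open>m\<close> steps to reach the axis.  The range
  \<open>k \<le> m + n + 1\<close> is closed under the recurrence and meets the line \<open>n = 0\<close> exactly there.
\<close>

section \<open>Weighted Motzkin paths\<close>

lemma height_append:
  "i \<le> length s \<Longrightarrow> height m (s @ u) i = height m s i"
  by (simp add: height_def nth_append)

lemma height_snoc_end:
  "height m (s @ [x]) (Suc (length s)) = height m s (length s) + rise x"
  by (simp add: height_def nth_append)

lemma height_lower_bound: "height m s i \<ge> int m - int i"
proof -
  have "rise x \<ge> -1" for x by (cases x) auto
  then have "(\<Sum>t<i. rise (s ! t)) \<ge> (\<Sum>t<i. -1)" by (intro sum_mono) auto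
  then show ?thesis by (simp add: height_def)
qed

lemma motzkin_paths_to_axis_empty: "k < m \<Longrightarrow> motzkin_paths m k 0 = {}"
proof -
  assume "k < m"
  then have "height m s k \<noteq> 0" for s
    using height_lower_bound[where m = m and s = s and i = k] by linarith
  then show ?thesis by (simp add: motzkin_paths_def)
qed

lemma motzkin_paths_0: "motzkin_paths m 0 n = (if m = n then {[]} else {})"
  by (auto simp: motzkin_paths_def height_def)

lemma snoc_in_motzkin_paths_iff:
  "s @ [x] \<in> motzkin_paths m (Suc k) n \<longleftrightarrow>
     (\<exists>j. s \<in> motzkin_paths m k j \<and> int j + rise x = int n)"
proof (cases "length s = k")
  case True
  then have "height m (s @ [x]) (Suc k) = height m s k + rise x"
    and "\<And>i. i \<le> k \<Longrightarrow> height m (s @ [x]) i = height m s i"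
    using height_snoc_end[of m s x] height_append[of _ s m "[x]"] by auto
  then have "s @ [x] \<in> motzkin_paths m (Suc k) n \<longleftrightarrow>
      (\<forall>i\<le>k. height m s i \<ge> 0) \<and> height m s k + rise x = int n"
    using True by (auto simp: motzkin_paths_def le_Suc_eq)
  also have "\<dots> \<longleftrightarrow> (\<exists>j. s \<in> motzkin_paths m k j \<and> int j + rise x = int n)"
    using True by (auto simp: motzkin_paths_def intro!: exI[of _ "nat (height m s k)"])
  finally show ?thesis .
qed (auto simp: motzkin_paths_def)

lemma motzkin_paths_Suc:
  "motzkin_paths m (Suc k) n =
     (\<lambda>s. s @ [Hor]) ` motzkin_paths m k n \<union>
     ((\<lambda>s. s @ [Down]) ` motzkin_paths m k (Suc n) \<union>
      (if n = 0 then {} else (\<lambda>s. s @ [Up]) ` motzkin_paths m k (n - 1)))"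
  (is "?A = ?B")
proof (rule set_eqI)
  fix r
  show "r \<in> ?A \<longleftrightarrow> r \<in> ?B"
  proof (cases r rule: rev_cases)
    case Nil
    then show ?thesis by (auto simp: motzkin_paths_def)
  next
    case (snoc s x)
    have down: "int j - 1 = int n \<longleftrightarrow> j = Suc n" for j by auto
    have up: "int j + 1 = int n \<longleftrightarrow> n \<noteq> 0 \<and> j = n - 1" for j by auto
    show ?thesis
      by (cases x) (auto simp: snoc snoc_in_motzkin_paths_iff down up)
  qed
qed

lemma sum_motzkin_paths_Suc:
  fixes f :: "step list \<Rightarrow> real"
  shows "(\<Sum>s\<in>motzkin_paths m (Suc k) n. f s) =
     (\<Sum>s\<in>motzkin_paths m k n. f (s @ [Hor])) +
     ((\<Sum>s\<in>motzkin_paths m k (Suc n). f (s @ [Down])) +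
      (if n = 0 then 0 else \<Sum>s\<in>motzkin_paths m k (n - 1). f (s @ [Up])))"
proof -
  have img: "(\<Sum>r\<in>(\<lambda>s. s @ [x]) ` A. f r) = (\<Sum>s\<in>A. f (s @ [x]))" for x A
    by (subst sum.reindex) (auto simp: inj_on_def)
  show ?thesis
    unfolding motzkin_paths_Suc
    by (subst sum.union_disjoint; (subst sum.union_disjoint)?)
      (auto simp: finite_motzkin_paths img)
qed

text \<open>
  Only the weight of a \<open>Down\<close> looks ahead, and only at whether an \<open>Up\<close> follows.  Hence the weight
  splits at every cut that does not separate such a pair.
\<close>

lemma path_weight_append:
  assumes cut: "s = [] \<or> last s \<noteq> Down \<or> u = [] \<or> hd u \<noteq> Up"
  shows "path_weight b lam m (s @ u) =
    path_weight b lam m s * (\<Prod>i<length u. edge_weight b lam m (s @ u) (length s + i))"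
proof -
  have "edge_weight b lam m (s @ u) i = edge_weight b lam m s i" if i: "i < length s" for i
  proof (cases "Suc i < length s")
    case True
    then show ?thesis
      using i by (simp add: edge_weight_def Let_def height_append nth_append split: step.split)
  next
    case False
    then have "Suc i = length s" using i by simp
    then have "last s = s ! i" and "s \<noteq> []"
      by (metis diff_Suc_1 last_conv_nth length_0_conv nat.distinct(1), auto)
    then show ?thesis
      using cut i \<open>Suc i = length s\<close>
      by (cases u) (auto simp: edge_weight_def Let_def height_append nth_append split: step.split)
  qed
  moreover have "prod f {..<j + l} = prod f {..<j} * (\<Prod>i<l. f (j + i))"
    for f :: "nat \<Rightarrow> real" and j l
    by (induction l) (simp_all add: mult.assoc)
  ultimately show ?thesis
    by (simp add: path_weight_def)
qed

lemma path_weight_snoc_Hor: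
  assumes "s \<in> motzkin_paths m k n"
  shows "path_weight b lam m (s @ [Hor]) = path_weight b lam m s * (b n - b k)"
  using assms path_weight_append[of s "[Hor]" b lam m]
  by (auto simp: edge_weight_def motzkin_paths_def height_append)

lemma path_weight_snoc_Down:
  assumes "s \<in> motzkin_paths m k n"
  shows "path_weight b lam m (s @ [Down]) = path_weight b lam m s * lam n"
  using assms path_weight_append[of s "[Down]" b lam m]
  by (auto simp: edge_weight_def motzkin_paths_def height_append)

text \<open>
  Appending an \<open>Up\<close> turns a final factor \<open>\<lambda>\<^sub>j\<close> of a \<open>Down\<close> into \<open>\<lambda>\<^sub>j - \<lambda>\<^sub>k\<close>, where \<open>k\<close> is the length
  of the path: the \<open>Down\<close> starts at abscissa \<open>k - 1\<close>.
\<close>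

lemma path_weight_snoc_Up:
  "path_weight b lam m (s @ [Up]) =
     path_weight b lam m s -
       (if s \<noteq> [] \<and> last s = Down then lam (length s) * path_weight b lam m (butlast s) else 0)"
proof (cases "s \<noteq> [] \<and> last s = Down")
  case True
  then obtain t where s: "s = t @ [Down]" by (metis append_butlast_last_id)
  have "path_weight b lam m (t @ [Down, Up]) =
      path_weight b lam m t * (lam (nat (height m t (length t))) - lam (Suc (length t)))"
    using path_weight_append[of t "[Down, Up]" b lam m]
    by (simp add: edge_weight_def height_append nth_append lessThan_Suc numeral_2_eq_2)
  moreover have "path_weight b lam m (t @ [Down]) =
      path_weight b lam m t * lam (nat (height m t (length t)))"
    using path_weight_append[of t "[Down]" b lam m]
    by (simp add: edge_weight_def height_append nth_append)
  ultimately show ?thesis by (simp add: s algebra_simps)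
next
  case False
  then show ?thesis
    using path_weight_append[of s "[Up]" b lam m] by (auto simp: edge_weight_def)
qed

text \<open>
  The paths to \<open>(k, n)\<close> whose weight is corrected are those ending in \<open>Down\<close>.  Without that step
  they are exactly the paths to \<open>(k - 1, n + 1)\<close>: adding a \<open>Down\<close> back never leaves the upper
  half-plane.  This is why the correction is a full path sum.
\<close>

lemma sum_path_weight_snoc_Up:
  "(\<Sum>s\<in>motzkin_paths m k n. path_weight b lam m (s @ [Up])) =
     (\<Sum>s\<in>motzkin_paths m k n. path_weight b lam m s) -
       (if k = 0 then 0
        else lam k * (\<Sum>s\<in>motzkin_paths m (k - 1) (Suc n). path_weight b lam m s))"
proof -
  define c where "c s = (if s \<noteq> [] \<and> last s = Down
      then lam k * path_weight b lam m (butlast s) else 0)" for s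
  have "(\<Sum>s\<in>motzkin_paths m k n. path_weight b lam m (s @ [Up])) =
      (\<Sum>s\<in>motzkin_paths m k n. path_weight b lam m s - c s)"
    by (intro sum.cong refl) (auto simp: c_def path_weight_snoc_Up motzkin_paths_def)
  moreover have "(\<Sum>s\<in>motzkin_paths m k n. c s) = (if k = 0 then 0
      else lam k * (\<Sum>s\<in>motzkin_paths m (k - 1) (Suc n). path_weight b lam m s))"
  proof (cases k)
    case 0
    then show ?thesis by (simp add: motzkin_paths_0 c_def)
  next
    case (Suc l)
    then show ?thesis
      by (simp only: sum_motzkin_paths_Suc) (simp add: c_def sum_distrib_left)
  qed
  ultimately show ?thesis by (simp add: sum_subtractf)
qed

lemma path_weight_sum_recurrence:
  fixes b lam :: "nat \<Rightarrow> real" and m :: nat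
  defines "S \<equiv> \<lambda>k n. \<Sum>s\<in>motzkin_paths m k n. path_weight b lam m s"
  shows "S (Suc k) n = (b n - b k) * S k n + lam (Suc n) * S k (Suc n) +
    (if n = 0 then 0 else S k (n - 1) - (if k = 0 then 0 else lam k * S (k - 1) n))"
proof -
  have "(\<Sum>s\<in>motzkin_paths m k n. path_weight b lam m (s @ [Hor])) = (b n - b k) * S k n"
    unfolding S_def sum_distrib_left
    by (intro sum.cong refl) (simp add: path_weight_snoc_Hor)
  moreover have "(\<Sum>s\<in>motzkin_paths m k (Suc n). path_weight b lam m (s @ [Down])) =
      lam (Suc n) * S k (Suc n)"
    unfolding S_def sum_distrib_left
    by (intro sum.cong refl) (simp add: path_weight_snoc_Down)
  ultimately show ?thesis
    unfolding S_def sum_motzkin_paths_Suc by (simp add: sum_path_weight_snoc_Up)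
qed

section \<open>Monic orthogonal polynomials\<close>

locale monic_orthogonal =
  fixes b lam :: "nat \<Rightarrow> real" and p :: "nat \<Rightarrow> real poly" and L :: "real poly \<Rightarrow> real"
  assumes p_0: "p 0 = 1"
    and p_Suc: "p (Suc n) =
      [:- b n, 1:] * p n - (if n = 0 then 0 else smult (lam n) (p (n - 1)))"
    and L_linear: "Vector_Spaces.linear smult (*) L"
    and L_1: "L 1 = 1"
    and L_orthogonal: "i \<noteq> j \<Longrightarrow> L (p i * p j) = 0"
begin

lemma L_add: "L (q + r) = L q + L r"
  and L_smult: "L (smult c q) = c * L q"
proof -
  interpret Vector_Spaces.linear smult "(*)" L by (rule L_linear)
  show "L (q + r) = L q + L r" by (rule add)
  show "L (smult c q) = c * L q" by (rule scale)
qed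

lemma L_mult_X:
  "L ([:0, 1:] * (p n * q)) =
     L (p (Suc n) * q) + b n * L (p n * q) + (if n = 0 then 0 else lam n * L (p (n - 1) * q))"
proof -
  have X: "[:0, 1:] * p n = p (Suc n) + smult (b n) (p n) +
      smult (if n = 0 then 0 else lam n) (p (n - 1))"
    by (simp add: p_Suc)
  have "[:0, 1:] * (p n * q) = ([:0, 1:] * p n) * q" by (simp only: mult.assoc)
  also have "\<dots> = p (Suc n) * q + smult (b n) (p n * q) +
      smult (if n = 0 then 0 else lam n) (p (n - 1) * q)"
    unfolding X by (simp only: distrib_right mult_smult_left)
  finally show ?thesis by (simp add: L_add L_smult)
qed

lemma L_square: "L (p n * p n) = (\<Prod>i=1..n. lam i)"
proof (induction n)
  case 0
  show ?case by (simp add: p_0 L_1)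
next
  case (Suc n)
  \<comment> \<open>Evaluate \<open>L (x p\<^sub>n p\<^bsub>n+1\<^esub>)\<close> by multiplying \<open>x\<close> into either factor.\<close>
  have "L (p (Suc n) * p (Suc n)) = L ([:0, 1:] * (p n * p (Suc n)))"
    by (subst L_mult_X) (simp add: L_orthogonal)
  also have "\<dots> = L ([:0, 1:] * (p (Suc n) * p n))" by (simp only: mult.commute)
  also have "\<dots> = lam (Suc n) * L (p n * p n)"
    by (subst L_mult_X) (simp add: L_orthogonal)
  finally show ?case by (simp add: Suc.IH)
qed

text \<open>
  The two ways of multiplying \<open>x\<close> into \<open>q p\<^sub>n p\<^sub>k\<close>, through \<open>p\<^sub>n\<close> and through \<open>p\<^sub>k\<close>, must agree.
\<close>

lemma triple_product_recurrence:
  "L (q * p n * p (Suc k)) = (b n - b k) * L (q * p n * p k) + L (q * p (Suc n) * p k) +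
     (if n = 0 then 0 else lam n * L (q * p (n - 1) * p k)) -
     (if k = 0 then 0 else lam k * L (q * p n * p (k - 1)))"
proof -
  have "L ([:0, 1:] * (p k * (q * p n))) = L ([:0, 1:] * (p n * (q * p k)))"
    by (simp only: ac_simps)
  then show ?thesis
    unfolding L_mult_X by (cases "n = 0"; cases "k = 0") (simp_all add: algebra_simps)
qed

lemma linearization:
  assumes "k \<le> m + n + 1"
  shows "L (p m * p n * p k) =
    (\<Prod>i=1..n. lam i) * (\<Sum>s\<in>motzkin_paths m k n. path_weight b lam m s)"
  using assms
proof (induction k arbitrary: n rule: less_induct)
  case (less k)
  define S where "S k n = (\<Sum>s\<in>motzkin_paths m k n. path_weight b lam m s)" for k n
  define Lam where "Lam n = (\<Prod>i=1..n. lam i)" for n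
  have IH: "L (p m * p j * p l) = Lam j * S l j" if "l < k" "l \<le> m + j + 1" for l j
    using less.IH[OF that] by (simp add: Lam_def S_def)
  have Lam_Suc: "Lam (Suc j) = Lam j * lam (Suc j)" for j
    by (simp add: Lam_def)
  have "L (p m * p n * p k) = Lam n * S k n"
  proof (cases k)
    case 0
    then show ?thesis
      by (cases "m = n")
        (simp_all add: p_0 L_square L_orthogonal S_def Lam_def motzkin_paths_0 path_weight_def)
  next
    case (Suc l)
    have S_rec: "S (Suc l) n = (b n - b l) * S l n + lam (Suc n) * S l (Suc n) +
        (if n = 0 then 0 else S l (n - 1) - (if l = 0 then 0 else lam l * S (l - 1) n))"
      unfolding S_def by (rule path_weight_sum_recurrence)
    have IHs: "L (p m * p n * p l) = Lam n * S l n"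
      "L (p m * p (Suc n) * p l) = Lam (Suc n) * S l (Suc n)"
      "L (p m * p n * p (l - 1)) = Lam n * S (l - 1) n"
      using Suc less.prems by (auto intro: IH)
    \<comment> \<open>The product of the \<open>\<lambda>\<^sub>i\<close> absorbs the factor \<open>\<lambda>\<^sub>n\<close> of the term at \<open>n - 1\<close>.\<close>
    have pred: "lam n * L (p m * p (n - 1) * p l) = Lam n * S l (n - 1)" if "n \<noteq> 0"
      using that Suc less.prems IH[of l "n - 1"] Lam_Suc[of "n - 1"] by simp
    have L_rec: "L (p m * p n * p k) = (b n - b l) * (Lam n * S l n) + Lam (Suc n) * S l (Suc n) +
        (if n = 0 then 0 else Lam n * S l (n - 1)) -
        (if l = 0 then 0 else lam l * (Lam n * S (l - 1) n))"
      unfolding Suc triple_product_recurrence IHs using pred by simp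
    show ?thesis
    proof (cases "n = 0")
      case True
      \<comment> \<open>The term that the path recurrence lacks on the axis vanishes.\<close>
      have "(if l = 0 then 0 else lam l * (Lam n * S (l - 1) n)) = 0"
        using Suc True less.prems by (simp add: S_def motzkin_paths_to_axis_empty)
      then have "L (p m * p n * p k) = Lam n * S (Suc l) n"
        unfolding L_rec S_rec by (simp add: True Lam_Suc algebra_simps)
      then show ?thesis by (simp add: Suc)
    next
      case False
      then have "L (p m * p n * p k) = Lam n * S (Suc l) n"
        unfolding L_rec S_rec by (simp add: Lam_Suc algebra_simps)
      then show ?thesis by (simp add: Suc)
    qed
  qed
  then show ?case by (simp add: S_def Lam_def)
qed

end

theorem theorem1:
  fixes \<alpha> \<beta> \<gamma> b lam :: "nat \<Rightarrow> real"
    and p :: "nat \<Rightarrow> real poly"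
    and L :: "real poly \<Rightarrow> real"
    and m n k :: nat
  assumes rec: "three_term_recurrence \<alpha> \<beta> \<gamma> p"
    and alpha: "\<And>i. \<alpha> i = 1"
    and beta: "\<And>i. \<beta> i = b i"
    and gamma: "\<And>i. \<gamma> i = lam (i + 1)"
    and functional: "functional_of L p"
    and range: "k \<le> m + n + 1"
  shows "L (p m * p n * p k) =
           (\<Prod>i=1..n. lam i) * (\<Sum>s\<in>motzkin_paths m k n. path_weight b lam m s)"
proof -
  interpret monic_orthogonal b lam p L
  proof (rule monic_orthogonal.intro)
    show "p 0 = 1" using rec by (simp add: three_term_recurrence_def)
    show "p (Suc n) = [:- b n, 1:] * p n - (if n = 0 then 0 else smult (lam n) (p (n - 1)))" for n
      using rec by (cases n) (simp_all add: three_term_recurrence_def alpha beta gamma)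
    show "Vector_Spaces.linear smult (*) L" "L 1 = 1" "\<And>i j. i \<noteq> j \<Longrightarrow> L (p i * p j) = 0"
      using functional by (auto simp: functional_of_def positive_definite_functional_def)
  qed
  show ?thesis using range by (rule linearization)
qed

end
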